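(* Let $G=(V,E)$ be a finite simple graph and let $1\le k\le |V|$. Then \[ \varepsilon_k(G)\le \max_{U\subset V,\ |U|=k} |E_G(U)| + (4k-2)\sqrt{k}. \]
   Context: The Laplacian matrix $L(G)\in\mathbb{R}^{V\times V}$ of a graph $G=(V,E)$ has $L(G)_{u,u}=\deg(u)$, $L(G)_{u,v}=-1$ if $\{u,v\}\in E$, and $0$ otherwise. For a symmetric matrix $M$, $\lambda_i(M)$ denotes its $i$-th largest eigenvalue. Define $\varepsilon_k(G)=\sum_{i=1}^k\lambda_i(L(G))-|E|$. For $U\subset V$, $E_G(U)=\{e\in E: e\subset U\}$. *)

theory Defs
  imports "HOL-Analysis.Analysis" "HOL-Computational_Algebra.Polynomial"
begin

text \<open>
  A finite simple graph is given by its vertex set, the universe of a finite type, and its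
  edge set, a set of two-element sets of vertices.
\<close>

definition simple_graph :: "'v::finite set set \<Rightarrow> bool" where
  "simple_graph E \<longleftrightarrow> (\<forall>e\<in>E. card e = 2)"

definition degree_in :: "'v::finite set set \<Rightarrow> 'v \<Rightarrow> nat" where
  "degree_in E u = card {v. {u, v} \<in> E}"

definition laplacian :: "'v::finite set set \<Rightarrow> real ^ 'v ^ 'v" where
  "laplacian E =
    (\<chi> u v. if u = v then real (degree_in E u) else if {u, v} \<in> E then -1 else 0)"

definition charpoly :: "real ^ 'n ^ 'n \<Rightarrow> real poly" where
  "charpoly M = det (mat [:0, 1:] - map_matrix (\<lambda>a. [:a:]) M)"

text \<open>
  The \<open>i\<close>-th largest eigenvalue, counted with multiplicity and starting from \<open>i = 1\<close>. It is
  meaningful for symmetric \<open>M\<close> and \<open>1 \<le> i \<le> CARD('n)\<close>: all roots of the characteristic polynomial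
  of a symmetric matrix are real, so that the list has length \<open>CARD('n)\<close>.
\<close>

definition eigval :: "real ^ 'n ^ 'n \<Rightarrow> nat \<Rightarrow> real" where
  "eigval M i = rev (sorted_list_of_multiset (proots (charpoly M))) ! (i - 1)"

definition graph_eps :: "nat \<Rightarrow> 'v::finite set set \<Rightarrow> real" where
  "graph_eps k E = (\<Sum>i=1..k. eigval (laplacian E) i) - real (card E)"

definition edges_within :: "'v::finite set set \<Rightarrow> 'v set \<Rightarrow> 'v set set" where
  "edges_within E U = {e \<in> E. e \<subseteq> U}"

end

theory Submission
  imports Defs
begin

text \<open>
  Let \<open>P\<close> be the orthogonal projection onto the span of \<open>k\<close> orthonormal eigenvectors for the \<open>k\<close>
  largest eigenvalues and \<open>p\<^sub>u = P\<^sub>u\<^sub>u\<close>, so that \<open>0 \<le> p\<^sub>u \<le> 1\<close> and \<open>\<Sum>\<^sub>u p\<^sub>u = k\<close>. Then the excess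
  is the sum over the edges \<open>uv\<close> of \<open>p\<^sub>u + p\<^sub>v - 2 P\<^sub>u\<^sub>v - 1\<close>. The sum of the positive parts of
  \<open>p\<^sub>u + p\<^sub>v - 1\<close> is convex in \<open>p\<close>, hence at most its maximum over the vertices of the hypersimplex,
  which are the indicators of the \<open>k\<close>-sets \<open>U\<close> and give the number of edges within \<open>U\<close>.

  Only edges with \<open>p\<^sub>u + p\<^sub>v - 2 P\<^sub>u\<^sub>v > 1\<close> contribute positively. A matching of such edges has fewer
  than \<open>2k\<close> elements because \<open>p\<^sub>u + p\<^sub>v - 2 P\<^sub>u\<^sub>v \<le> 2 (p\<^sub>u + p\<^sub>v)\<close>, so the vertices of a maximal
  matching form a cover \<open>B\<close> of these edges with \<open>|B| \<le> 4k - 2\<close>. For fixed \<open>u\<close> in \<open>B\<close> the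
  off-diagonal terms are controlled by AM-GM with weight \<open>\<surd>k\<close>, using
  \<open>\<Sum>\<^sub>v\<^sub>\<noteq>\<^sub>u P\<^sub>u\<^sub>v\<^sup>2 = p\<^sub>u (1 - p\<^sub>u)\<close>; edges inside \<open>B\<close> are charged half to each end.
\<close>

subsection \<open>Spectral theorem for real symmetric matrices\<close>

lemma symmetric_matrix_inner:
  fixes M :: "real ^ 'n ^ 'n"
  assumes "transpose M = M"
  shows "(M *v x) \<bullet> y = x \<bullet> (M *v y)"
  by (metis assms dot_lmul_matrix transpose_matrix_vector)

text \<open>A maximiser of \<open>x \<bullet> (M *v x)\<close> over the unit vectors orthogonal to
  \<open>B\<close> is an eigenvector: its residual stays in that complement, because
  \<open>M\<close> maps the complement to itself.\<close>

lemma symmetric_matrix_eigenvector_orthogonal_to: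
  fixes M :: "real ^ 'n ^ 'n" and B :: "(real ^ 'n) set"
  assumes sym: "transpose M = M"
    and fin: "finite B" and card: "card B < CARD('n)"
    and eig: "\<And>b. b \<in> B \<Longrightarrow> \<exists>c. M *v b = c *\<^sub>R b"
  obtains x c where "norm x = 1" "\<And>b. b \<in> B \<Longrightarrow> x \<bullet> b = 0" "M *v x = c *\<^sub>R x"
proof -
  define S where "S = {x. \<forall>b\<in>B. x \<bullet> b = 0}"
  have "dim (span B) < DIM(real ^ 'n)"
    using dim_le_card'[OF fin] card by simp
  then obtain z where z: "z \<noteq> 0" "\<And>y. y \<in> span (span B) \<Longrightarrow> orthogonal z y"
    using orthogonal_to_subspace_exists by (metis dim_span)
  have zS: "z \<in> S"
    using z(2) by (auto simp: S_def orthogonal_def span_base)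
  have scaleS: "a *\<^sub>R x \<in> S" if "x \<in> S" for a x
    using that by (auto simp: S_def)
  have addS: "x + y \<in> S" if "x \<in> S" "y \<in> S" for x y
    using that by (auto simp: S_def inner_add_left)
  have MS: "M *v x \<in> S" if "x \<in> S" for x
    unfolding S_def
  proof safe
    fix b assume b: "b \<in> B"
    then obtain c where "M *v b = c *\<^sub>R b" using eig by blast
    then show "(M *v x) \<bullet> b = 0"
      using that b by (simp add: symmetric_matrix_inner[OF sym] S_def)
  qed
  have "closed S"
  proof -
    have "S = (\<Inter>b\<in>B. {x. b \<bullet> x = 0})"
      by (auto simp: S_def inner_commute)
    then show ?thesis
      by (simp add: closed_hyperplane closed_INT)
  qed
  then have "compact (sphere 0 1 \<inter> S)"
    by (simp add: compact_Int_closed)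
  moreover have "(1 / norm z) *\<^sub>R z \<in> sphere 0 1 \<inter> S"
    using z(1) scaleS[OF zS] by simp
  moreover have "continuous_on (sphere 0 1 \<inter> S) (\<lambda>x. x \<bullet> (M *v x))"
    by (intro continuous_intros linear_continuous_on)
       (simp add: matrix_vector_mul_bounded_linear)
  ultimately obtain x where x: "x \<in> sphere 0 1 \<inter> S"
    and xmax: "\<And>y. y \<in> sphere 0 1 \<inter> S \<Longrightarrow> y \<bullet> (M *v y) \<le> x \<bullet> (M *v x)"
    using continuous_attains_sup[of "sphere 0 1 \<inter> S" "\<lambda>x. x \<bullet> (M *v x)"] by blast
  define c where "c = x \<bullet> (M *v x)"
  have nx: "norm x = 1" and xS: "x \<in> S" using x by auto
  \<comment> \<open>Homogeneity extends the bound from the unit sphere to all of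
    \<open>S\<close>.\<close>
  have le: "y \<bullet> (M *v y) \<le> c * (y \<bullet> y)" if "y \<in> S" for y
  proof (cases "y = 0")
    case False
    have "((1 / norm y) *\<^sub>R y) \<bullet> (M *v ((1 / norm y) *\<^sub>R y)) \<le> c"
      unfolding c_def by (rule xmax) (use False scaleS[OF that] in simp)
    then have "(y \<bullet> (M *v y)) / (norm y)\<^sup>2 \<le> c"
      by (simp add: matrix_vector_mult_scaleR power2_eq_square)
    then show ?thesis
      using False by (simp add: divide_le_eq power2_norm_eq_inner)
  qed simp
  define w where "w = M *v x - c *\<^sub>R x"
  have wS: "w \<in> S"
    using addS[OF MS[OF xS] scaleS[OF xS, of "-c"]] by (simp add: w_def)
  define d where "d = w \<bullet> (M *v w) - c * (w \<bullet> w)"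
  \<comment> \<open>Perturbing \<open>x\<close> along the residual \<open>w\<close> cannot beat the
    maximum \<open>c\<close>; the term linear in \<open>t\<close> then forces \<open>w\<close> to
    vanish.\<close>
  have quad: "2 * t * (w \<bullet> w) + t\<^sup>2 * d \<le> 0" for t
  proof -
    have "(x + t *\<^sub>R w) \<bullet> (M *v (x + t *\<^sub>R w)) \<le> c * ((x + t *\<^sub>R w) \<bullet> (x + t *\<^sub>R w))"
      by (rule le[OF addS[OF xS scaleS[OF wS]]])
    moreover have "x \<bullet> (M *v w) = w \<bullet> (M *v x)"
      by (metis inner_commute symmetric_matrix_inner[OF sym])
    moreover have "w \<bullet> (M *v x) = w \<bullet> w + c * (w \<bullet> x)"
      by (simp add: w_def inner_diff_right inner_diff_left)
    moreover have "x \<bullet> x = 1"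
      using nx by (simp add: norm_eq_1)
    ultimately show ?thesis
      using c_def
      by (simp add: d_def matrix_vector_right_distrib matrix_vector_mult_scaleR inner_add_left
          inner_add_right inner_commute algebra_simps power2_eq_square)
  qed
  have "w \<bullet> w = 0"
  proof (rule ccontr)
    assume "w \<bullet> w \<noteq> 0"
    then have pos: "w \<bullet> w > 0" by simp
    \<comment> \<open>This choice makes \<open>t * \<bar>d\<bar> < w \<bullet> w\<close>, so the
      linear term dominates the quadratic one.\<close>
    define t where "t = (w \<bullet> w) / (\<bar>d\<bar> + 1)"
    have t: "t > 0" "t * (\<bar>d\<bar> + 1) = w \<bullet> w"
      using pos by (auto simp: t_def)
    have "t * (2 * (w \<bullet> w) + t * d) \<le> 0"
      using quad[of t] by (simp add: algebra_simps power2_eq_square)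
    then have "2 * (w \<bullet> w) + t * d \<le> 0"
      using t(1) by (simp add: mult_le_0_iff)
    moreover have "- (t * d) \<le> t * \<bar>d\<bar>"
      using mult_left_mono[of "-d" "\<bar>d\<bar>" t] t(1) by simp
    ultimately show False
      using t pos by (simp add: algebra_simps)
  qed
  then have "M *v x = c *\<^sub>R x" by (simp add: w_def)
  with nx xS show ?thesis by (intro that) (auto simp: S_def)
qed

text \<open>Eigenvectors are collected one at a time in an orthonormal set. Indexing it by the
  coordinate type lets them serve as columns of a square matrix.\<close>

lemma symmetric_matrix_orthonormal_eigenvectors:
  fixes M :: "real ^ 'n ^ 'n"
  assumes sym: "transpose M = M"
  obtains x :: "'n \<Rightarrow> real ^ 'n" and c where
    "\<And>i j. x i \<bullet> x j = (if i = j then 1 else 0)" "\<And>i. M *v x i = c i *\<^sub>R x i"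
proof -
  have ex: "\<exists>B :: (real ^ 'n) set. finite B \<and> card B = m \<and> pairwise orthogonal B \<and>
      (\<forall>b\<in>B. norm b = 1 \<and> (\<exists>c. M *v b = c *\<^sub>R b))" if "m \<le> CARD('n)" for m
    using that
  proof (induction m)
    case 0
    show ?case by (intro exI[of _ "{}"]) simp
  next
    case (Suc m)
    then obtain B :: "(real ^ 'n) set" where B: "finite B" "card B = m" "pairwise orthogonal B"
      "\<And>b. b \<in> B \<Longrightarrow> norm b = 1" "\<And>b. b \<in> B \<Longrightarrow> \<exists>c. M *v b = c *\<^sub>R b"
      by auto
    obtain y c where y: "norm y = 1" "\<And>b. b \<in> B \<Longrightarrow> y \<bullet> b = 0" "M *v y = c *\<^sub>R y"
      using symmetric_matrix_eigenvector_orthogonal_to[OF sym B(1) _ B(5)] B(2) Suc.prems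
      by (metis Suc_le_eq)
    have "y \<notin> B"
      using y(1) y(2)[of y] by (auto simp: norm_eq_1)
    moreover have "pairwise orthogonal (insert y B)"
      using B(3) y(2) by (auto simp: pairwise_insert orthogonal_def inner_commute)
    ultimately show ?case
      using B y by (intro exI[of _ "insert y B"]) auto
  qed
  obtain B :: "(real ^ 'n) set" where B: "finite B" "card B = CARD('n)" "pairwise orthogonal B"
      "\<And>b. b \<in> B \<Longrightarrow> norm b = 1" "\<And>b. b \<in> B \<Longrightarrow> \<exists>c. M *v b = c *\<^sub>R b"
    using ex[OF order_refl] by auto
  obtain x where x: "bij_betw x (UNIV :: 'n set) B"
    using finite_same_card_bij[of "UNIV :: 'n set" B] B by auto
  have xB: "x i \<in> B" for i using x by (auto simp: bij_betw_def)
  have "x i \<bullet> x j = (if i = j then 1 else 0)" for i j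
  proof (cases "i = j")
    case False
    then have "x i \<noteq> x j" using x by (auto simp: bij_betw_def inj_on_def)
    then show ?thesis using B(3) xB False by (auto simp: pairwise_def orthogonal_def)
  qed (use B(4)[OF xB] in \<open>simp add: norm_eq_1\<close>)
  moreover obtain c where "\<And>i. M *v x i = c i *\<^sub>R x i"
    using B(5)[OF xB] by metis
  ultimately show ?thesis using that by blast
qed

section \<open>Eigenvalues as roots of the characteristic polynomial\<close>

text \<open>With the eigenvectors as columns of \<open>Q\<close>, the identity
  \<open>A ** Q = Q ** D\<close> holds over polynomials, and \<open>det Q\<close> cancels because
  orthonormality makes it nonzero.\<close>

lemma charpoly_eq_prod_of_orthonormal_eigenvectors:
  fixes M :: "real ^ 'n ^ 'n" and x :: "'n \<Rightarrow> real ^ 'n"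
  assumes orth: "\<And>i j. x i \<bullet> x j = (if i = j then 1 else 0)"
    and eig: "\<And>i. M *v x i = c i *\<^sub>R x i"
  shows "charpoly M = (\<Prod>i\<in>UNIV. [:- c i, 1:])"
proof -
  define Q :: "real poly ^ 'n ^ 'n" where "Q = (\<chi> i j. [:x j $ i:])"
  define D :: "real poly ^ 'n ^ 'n" where "D = (\<chi> i j. if i = j then [:- c i, 1:] else 0)"
  define A where "A = mat [:0, 1:] - map_matrix (\<lambda>a. [:a:]) M"
  have sum_const: "(\<Sum>l\<in>UNIV. [:f l:]) = [:\<Sum>l\<in>UNIV. f l:]" for f :: "'n \<Rightarrow> real"
    by (induction rule: infinite_finite_induct) auto
  have "transpose Q ** Q = mat 1"
    using orth
    by (simp add: vec_eq_iff matrix_matrix_mult_def transpose_def Q_def mat_def sum_const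
        inner_vec_def one_pCons)
  then have "det (transpose Q) * det Q = 1"
    by (metis det_I det_mul)
  then have "det Q \<noteq> 0" by auto
  have Mx: "(\<Sum>l\<in>UNIV. M $ i $ l * x j $ l) = c j * x j $ i" for i j
    using arg_cong[OF eig[of j], of "\<lambda>v. v $ i"] by (simp add: matrix_vector_mult_def)
  have "(\<Sum>l\<in>UNIV. (mat [:0, 1:] $ i $ l - [:M $ i $ l:]) * [:x j $ l:])
      = [:- (c j * x j $ i), x j $ i:]" for i j
  proof -
    have "(\<Sum>l\<in>UNIV. (mat [:0, 1:] $ i $ l - [:M $ i $ l:]) * [:x j $ l:])
      = (\<Sum>l\<in>UNIV. (if i = l then [:0, x j $ l:] else 0) - [:M $ i $ l * x j $ l:])"
      by (intro sum.cong) (auto simp: mat_def algebra_simps)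
    also have "\<dots> = [:0, x j $ i:] - [:c j * x j $ i:]"
      by (simp add: sum_subtractf sum_const Mx)
    finally show ?thesis by simp
  qed
  then have "A ** Q = Q ** D"
    by (simp add: vec_eq_iff matrix_matrix_mult_def A_def Q_def D_def if_distrib
        cong: if_cong)
  then have "det A * det Q = det Q * det D"
    by (metis det_mul)
  then have "det A = det D" using \<open>det Q \<noteq> 0\<close> by simp
  also have "det D = (\<Prod>i\<in>UNIV. [:- c i, 1:])"
    by (subst det_diagonal) (auto simp: D_def)
  finally show ?thesis by (simp add: charpoly_def A_def)
qed

text \<open>This ties the list-based \<open>eigval\<close> to an eigenbasis. Sorting the indices
  rather than the values keeps repeated eigenvalues apart, and \<open>I\<close> holds the first
  \<open>k\<close> indices.\<close>

lemma sum_eigval_eq_sum_eigenvectors: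
  fixes M :: "real ^ 'n ^ 'n" and x :: "'n \<Rightarrow> real ^ 'n"
  assumes orth: "\<And>i j. x i \<bullet> x j = (if i = j then 1 else 0)"
    and eig: "\<And>i. M *v x i = c i *\<^sub>R x i"
    and k: "k \<le> CARD('n)"
  obtains I where "card I = k" "(\<Sum>i=1..k. eigval M i) = (\<Sum>i\<in>I. c i)"
proof -
  obtain l :: "'n list" where l: "set l = UNIV" "distinct l"
    using finite_distinct_list[OF finite] by blast
  define r where "r = rev (sort_key c l)"
  have r: "set r = UNIV" "distinct r" by (simp_all add: r_def l)
  then have len: "length r = CARD('n)"
    using distinct_card by fastforce
  have "proots (charpoly M) = (\<Sum>i\<in>UNIV. {#c i#})"
    by (simp add: charpoly_eq_prod_of_orthonormal_eigenvectors[OF orth eig] proots_prod)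
  also have "\<dots> = image_mset c (mset_set UNIV)"
    by (simp add: sum_unfold_sum_mset)
  also have "\<dots> = mset (map c l)"
    using l by (metis mset_map mset_set_set)
  finally have "sorted_list_of_multiset (proots (charpoly M)) = sort (map c l)"
    by (simp only: sorted_list_of_multiset_mset)
  also have "\<dots> = map c (sort_key c l)"
    by (rule properties_for_sort) auto
  finally have ev: "eigval M i = map c r ! (i - 1)" for i
    by (simp add: eigval_def r_def rev_map)
  have "(\<Sum>i=1..k. eigval M i) = (\<Sum>i<k. c (r ! i))"
    using k len by (simp add: ev sum.atLeast1_atMost_eq)
  also have "\<dots> = (\<Sum>i\<in>(!) r ` {..<k}. c i)"
    using r(2) k len by (subst sum.reindex) (auto simp: inj_on_nth)
  finally show ?thesis
    using r(2) k len by (intro that[of "(!) r ` {..<k}"]) (auto simp: card_image inj_on_nth)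
qed

subsection \<open>Edge sums\<close>

lemma simple_graph_edgeE:
  assumes "simple_graph E" "e \<in> E"
  obtains u v where "e = {u, v}" "u \<noteq> v"
  using assms by (auto simp: simple_graph_def card_2_iff)

text \<open>The left side runs over the edges with a chosen orientation. This turns edge sums into
  row sums.\<close>

lemma sum_edges_ordered_pairs:
  fixes f :: "'v::finite \<Rightarrow> 'v \<Rightarrow> real"
  assumes "simple_graph E"
  shows "(\<Sum>e\<in>E. \<Sum>u\<in>e. \<Sum>v\<in>e - {u}. f u v) = (\<Sum>u\<in>UNIV. \<Sum>v | {u, v} \<in> E. f u v)"
proof -
  have edge: "e \<in> E \<and> u \<in> e \<and> v \<in> e \<and> v \<noteq> u \<longleftrightarrow> e = {u, v} \<and> {u, v} \<in> E" for e u v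
  proof
    assume *: "e \<in> E \<and> u \<in> e \<and> v \<in> e \<and> v \<noteq> u"
    then obtain a b where "e = {a, b}" using simple_graph_edgeE[OF assms] by metis
    with * show "e = {u, v} \<and> {u, v} \<in> E" by (auto simp: insert_commute)
  next
    assume "e = {u, v} \<and> {u, v} \<in> E"
    then show "e \<in> E \<and> u \<in> e \<and> v \<in> e \<and> v \<noteq> u"
      using assms by (auto simp: simple_graph_def)
  qed
  have "(\<Sum>e\<in>E. \<Sum>u\<in>e. \<Sum>v\<in>e - {u}. f u v)
      = (\<Sum>(e, u, v)\<in>(SIGMA e:E. SIGMA u:e. e - {u}). f u v)"
    by (simp add: sum.Sigma)
  also have "(SIGMA e:E. SIGMA u:e. e - {u}) = {(e, u, v). e = {u, v} \<and> {u, v} \<in> E}"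
    unfolding edge[symmetric] by auto
  also have "(\<Sum>(e, u, v)\<in>\<dots>. f u v) = (\<Sum>(u, v)\<in>(SIGMA u:UNIV. {v. {u, v} \<in> E}). f u v)"
    by (rule sum.reindex_bij_witness[of _ "\<lambda>(u, v). ({u, v}, u, v)" "\<lambda>(e, u, v). (u, v)"])
       auto
  also have "\<dots> = (\<Sum>u\<in>UNIV. \<Sum>v | {u, v} \<in> E. f u v)"
    by (simp add: sum.Sigma)
  finally show ?thesis .
qed

text \<open>On an edge \<open>{u, v}\<close> the inner sums give
  \<open>(x $ u - x $ v)\<^sup>2\<close>. Keeping the products separate lets a sum over eigenvectors
  produce the entries of \<open>P\<close>.\<close>

lemma laplacian_quadratic_form:
  fixes E :: "'v::finite set set" and x :: "real ^ 'v"
  assumes "simple_graph E"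
  shows "x \<bullet> (laplacian E *v x) = (\<Sum>e\<in>E. \<Sum>u\<in>e. \<Sum>v\<in>e - {u}. x $ u * x $ u - x $ u * x $ v)"
proof -
  have ne: "u \<noteq> v" if "{u, v} \<in> E" for u v
    using assms that by (auto simp: simple_graph_def)
  have row: "(laplacian E *v x) $ u = (\<Sum>v | {u, v} \<in> E. x $ u - x $ v)" for u
  proof -
    have "(laplacian E *v x) $ u =
      (\<Sum>v\<in>UNIV. (if u = v then real (degree_in E u) * x $ u else 0) - (if {u, v} \<in> E then x $ v else 0))"
      unfolding laplacian_def matrix_vector_mult_def
      by (simp, intro sum.cong) (use ne in auto)
    also have "\<dots> = real (degree_in E u) * x $ u - (\<Sum>v | {u, v} \<in> E. x $ v)"
      by (simp add: sum_subtractf sum.If_cases)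
    finally show ?thesis by (simp add: sum_subtractf degree_in_def)
  qed
  show ?thesis
    unfolding sum_edges_ordered_pairs[OF assms]
    by (simp add: inner_vec_def row sum_distrib_left right_diff_distrib)
qed

section \<open>Convexity over the hypersimplex\<close>

text \<open>Convexity is used along one segment at a time: shifting mass between two fractional
  coordinates places \<open>p\<close> between two points with fewer fractional coordinates.\<close>

lemma sum_pos_part_le_max_edges_within:
  fixes E :: "'v::finite set set" and p :: "'v \<Rightarrow> real"
  assumes E: "simple_graph E"
    and p: "\<And>u. 0 \<le> p u" "\<And>u. p u \<le> 1"
    and k: "(\<Sum>u\<in>UNIV. p u) = real k"
  shows "(\<Sum>e\<in>E. max 0 (sum p e - 1)) \<le> real (MAX U\<in>{U :: 'v set. card U = k}. card (edges_within E U))"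
    (is "?F p \<le> ?M")
  using p k
proof (induction "card {u. 0 < p u \<and> p u < 1}" arbitrary: p rule: less_induct)
  case less
  note p = less.prems
  show ?case
  proof (cases "\<exists>a. 0 < p a \<and> p a < 1")
    case False
    then have p01: "p u = 0 \<or> p u = 1" for u
      using p(1,2)[of u] by (metis less_eq_real_def)
    define U where "U = {u. p u = 1}"
    have pU: "p u = (if u \<in> U then 1 else 0)" for u
      using p01[of u] by (auto simp: U_def)
    have "real (card U) = real k"
      using p(3) by (simp add: pU sum.If_cases)
    then have "card U = k" by simp
    have "max 0 (sum p e - 1) = (if e \<subseteq> U then 1 else 0)" if "e \<in> E" for e
    proof -
      obtain u v where "e = {u, v}" "u \<noteq> v"
        using simple_graph_edgeE[OF E \<open>e \<in> E\<close>] .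
      then show ?thesis by (simp add: pU)
    qed
    then have "?F p = real (card (edges_within E U))"
      by (simp add: sum.If_cases edges_within_def Int_def cong: sum.cong)
    also have "\<dots> \<le> ?M"
      using \<open>card U = k\<close> by (intro of_nat_mono Max_ge) auto
    finally show ?thesis .
  next
    case True
    then obtain a where a: "0 < p a" "p a < 1" by blast
    \<comment> \<open>A single fractional coordinate would make the total non-integral.\<close>
    have "\<exists>b. b \<noteq> a \<and> 0 < p b \<and> p b < 1"
    proof (rule ccontr)
      assume "\<not> ?thesis"
      then have "p u \<in> \<int>" if "u \<noteq> a" for u
        using p(1,2)[of u] that by (metis Ints_0 Ints_1 less_eq_real_def)
      then have "(\<Sum>u\<in>UNIV - {a}. p u) \<in> \<int>"
        by (intro Ints_sum) auto
      moreover have "p a = real k - (\<Sum>u\<in>UNIV - {a}. p u)"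
        using p(3) by (simp add: sum.remove[of UNIV a])
      ultimately have "p a \<in> \<int>" by simp
      with a show False by (auto elim!: Ints_cases)
    qed
    then obtain b where b: "b \<noteq> a" "0 < p b" "p b < 1" by blast
    define q where "q t = p(a := p a + t, b := p b - t)" for t
    have sum_q: "sum (q t) A = sum p A + (if a \<in> A then t else 0) - (if b \<in> A then t else 0)" for t A
    proof -
      have "q t u = p u + (if u = a then t else 0) - (if u = b then t else 0)" for u
        using b(1) by (simp add: q_def)
      then show ?thesis
        by (simp add: sum.distrib sum_subtractf)
    qed
    have step: "?F (q t) \<le> ?M" if "q t a \<in> {0..1}" "q t b \<in> {0..1}" "q t a \<in> {0, 1} \<or> q t b \<in> {0, 1}" for t
    proof (rule less.hyps)
      have "{u. 0 < q t u \<and> q t u < 1} \<subseteq> {u. 0 < p u \<and> p u < 1}"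
      proof
        fix u assume "u \<in> {u. 0 < q t u \<and> q t u < 1}"
        then show "u \<in> {u. 0 < p u \<and> p u < 1}"
          using a b by (cases "u = a"; cases "u = b") (auto simp: q_def)
      qed
      moreover have "{u. 0 < q t u \<and> q t u < 1} \<noteq> {u. 0 < p u \<and> p u < 1}"
        using that(3) a b
        by (metis (mono_tags, lifting) insertE less_irrefl mem_Collect_eq singletonD)
      ultimately have "{u. 0 < q t u \<and> q t u < 1} \<subset> {u. 0 < p u \<and> p u < 1}" by blast
      then show "card {u. 0 < q t u \<and> q t u < 1} < card {u. 0 < p u \<and> p u < 1}"
        by (simp add: psubset_card_mono)
      show "0 \<le> q t u" "q t u \<le> 1" for u
        using that(1,2) p(1,2)[of u] b(1) by (auto simp: q_def split: if_splits)
      show "sum (q t) UNIV = real k" using p(3) by (simp add: sum_q)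
    qed
    \<comment> \<open>\<open>s\<close> and \<open>- t\<close> are the extreme admissible shifts: at
      each of them coordinate \<open>a\<close> or \<open>b\<close> reaches 0 or 1.\<close>
    define s where "s = min (1 - p a) (p b)"
    define t where "t = min (p a) (1 - p b)"
    have pos: "s > 0" "t > 0" using a b by (auto simp: s_def t_def)
    have "?F (q s) \<le> ?M" "?F (q (- t)) \<le> ?M"
      using a b by (intro step; auto simp: q_def s_def t_def min_def)+
    then have "t * ?F (q s) + s * ?F (q (- t)) \<le> t * ?M + s * ?M"
      using pos by (intro add_mono mult_left_mono) auto
    \<comment> \<open>\<open>p\<close> is the convex combination of \<open>q s\<close> and
      \<open>q (- t)\<close> with weights proportional to \<open>t\<close> and
      \<open>s\<close>.\<close>
    moreover have "(s + t) * ?F p \<le> t * ?F (q s) + s * ?F (q (- t))"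
      unfolding sum_distrib_left sum.distrib[symmetric]
    proof (rule sum_mono)
      fix e assume "e \<in> E"
      have "(s + t) * (sum p e - 1) = t * (sum (q s) e - 1) + s * (sum (q (- t)) e - 1)"
        by (simp add: sum_q algebra_simps)
      also have "\<dots> \<le> t * max 0 (sum (q s) e - 1) + s * max 0 (sum (q (- t)) e - 1)"
        using pos by (intro add_mono mult_left_mono) auto
      finally show "(s + t) * max 0 (sum p e - 1) \<le> \<dots>"
        using pos by (cases "sum p e \<le> 1") (auto simp: max_def)
    qed
    ultimately have "(s + t) * ?F p \<le> (s + t) * ?M"
      by (simp add: algebra_simps)
    then show ?thesis using pos by simp
  qed
qed

section \<open>Maximal matchings and scalar estimates\<close>

text \<open>A nonempty member missing \<open>\<Union>N\<close> could be added to \<open>N\<close>,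
  against maximality. For edges, \<open>N\<close> is a maximal matching and its vertices form a
  cover.\<close>

lemma ex_maximal_disjoint_subfamily:
  fixes \<E> :: "'a set set"
  assumes "finite \<E>" "{} \<notin> \<E>"
  obtains N where "N \<subseteq> \<E>" "disjoint N" "\<And>e. e \<in> \<E> \<Longrightarrow> e \<inter> \<Union>N \<noteq> {}"
proof -
  have fin: "finite {N. N \<subseteq> \<E> \<and> disjoint N}"
    using assms(1) by simp
  have "{} \<in> {N. N \<subseteq> \<E> \<and> disjoint N}" by simp
  then have "{N. N \<subseteq> \<E> \<and> disjoint N} \<noteq> {}" by (metis empty_iff)
  from finite_has_maximal[OF fin this] obtain N where "N \<in> {N. N \<subseteq> \<E> \<and> disjoint N}"
    and max: "\<forall>N'\<in>{N. N \<subseteq> \<E> \<and> disjoint N}. N \<subseteq> N' \<longrightarrow> N = N'"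
    by (elim bexE)
  then have N: "N \<subseteq> \<E>" "disjoint N" by simp_all
  have "e \<inter> \<Union>N \<noteq> {}" if "e \<in> \<E>" for e
  proof
    assume dis: "e \<inter> \<Union>N = {}"
    then have "disjnt e n" "disjnt n e" if "n \<in> N" for n
      using that by (auto simp: disjnt_def)
    then have "disjoint (insert e N)"
      using N(2) by (simp add: pairwise_insert)
    then have "e \<in> N"
      using bspec[OF max, of "insert e N"] N(1) \<open>e \<in> \<E>\<close> by auto
    then have "e = {}" using dis by auto
    with assms(2) \<open>e \<in> \<E>\<close> show False by simp
  qed
  with N show ?thesis using that by blast
qed

text \<open>
  If \<open>p\<^sub>v < 1 - p\<^sub>u\<close>, the positive part on the left absorbs all but \<open>p\<^sub>v / a\<close> of the term \<open>(1 - p\<^sub>u) / a\<close>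
  from AM-GM; otherwise \<open>(1 - p\<^sub>u) / a \<le> p\<^sub>v / a\<close>. For \<open>p\<^sub>u = 1\<close> the quotient is \<open>0\<close>.
\<close>

lemma offdiag_excess_le:
  fixes a :: real
  assumes a: "a \<ge> 1" and pu: "pu \<le> 1" and pv: "0 \<le> pv"
    and y: "y\<^sup>2 \<le> pu * (1 - pu)"
  shows "2 * \<bar>y\<bar> - max 0 (1 - (pu + pv)) \<le> a * (y\<^sup>2 / (1 - pu)) + pv / a"
proof (cases "pu = 1")
  case True
  with y have "y = 0" by simp
  moreover have "0 \<le> pv / a" using a pv by simp
  ultimately show ?thesis by (simp add: max_def)
next
  case False
  define d where "d = 1 - pu"
  have d: "d > 0" using False pu by (simp add: d_def)
  have "0 \<le> (a * \<bar>y\<bar> - d)\<^sup>2 / (a * d)"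
    using a d by simp
  also have "\<dots> = a * (y\<^sup>2 / d) - 2 * \<bar>y\<bar> + d / a"
    using a d by (simp add: power2_diff power_mult_distrib field_simps power2_eq_square)
  finally have "2 * \<bar>y\<bar> \<le> a * (y\<^sup>2 / d) + d / a" by simp
  moreover have "d / a - max 0 (d - pv) \<le> pv / a"
  proof (cases "pv \<le> d")
    case True
    have "(d - pv) / a \<le> d - pv"
      using a True by (simp add: divide_le_eq mult_le_cancel_left1)
    then show ?thesis using True by (simp add: diff_divide_distrib)
  next
    case False
    then show ?thesis using a by (simp add: divide_right_mono)
  qed
  moreover have "1 - (pu + pv) = d - pv" by (simp add: d_def)
  ultimately show ?thesis by (simp add: d_def)
qed

text \<open>Here \<open>m\<close> stands for the size of the cover and \<open>q\<close> for its
  weight. After multiplication by \<open>sqrt k\<close> the claim is linear in \<open>q\<close>; the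
  sign of the coefficient decides whether \<open>0 \<le> q\<close> or \<open>q \<le> k\<close> is
  used.\<close>

lemma cover_total_le:
  fixes k m q :: real
  assumes k: "1 \<le> k" and q: "0 \<le> q" "q \<le> k" and m: "m \<le> 4 * k - 2"
  shows "sqrt k * q + ((m * q - q) / 2 + m * (k - q)) / sqrt k \<le> (4 * k - 2) * sqrt k"
proof -
  have "q * (k - 1 / 2 - m / 2) \<le> k * (4 * k - 2 - m)"
  proof (cases "k - 1 / 2 - m / 2 \<le> 0")
    case True
    then have "q * (k - 1 / 2 - m / 2) \<le> 0" using q by (simp add: mult_nonneg_nonpos)
    also have "0 \<le> k * (4 * k - 2 - m)" using k m by simp
    finally show ?thesis .
  next
    case False
    \<comment> \<open>The second factors compare because
      \<open>m \<le> 4 * k - 2 \<le> 6 * k - 3\<close>.\<close>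
    then show ?thesis using q k m by (intro mult_mono) auto
  qed
  then have "k * q + ((m * q - q) / 2 + m * (k - q)) \<le> (4 * k - 2) * k"
    by (simp add: algebra_simps diff_divide_distrib)
  then have "(k * q + ((m * q - q) / 2 + m * (k - q))) / sqrt k \<le> ((4 * k - 2) * k) / sqrt k"
    using k by (intro divide_right_mono) auto
  moreover have "k / sqrt k = sqrt k" using k by (simp add: real_div_sqrt)
  ultimately show ?thesis
    by (metis (no_types, lifting) add_divide_distrib times_divide_eq_left times_divide_eq_right)
qed

section \<open>The bound for projection matrices\<close>

text \<open>The hypotheses hold for any orthogonal projection of rank \<open>k\<close>:
  \<open>idem\<close> is the diagonal of \<open>P\<close> squared being \<open>P\<close>, and
  \<open>psd\<close> tests \<open>P\<close> on a sum of two unit vectors.\<close>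

lemma sum_edge_weights_of_projection_le:
  fixes E :: "'v::finite set set" and P :: "'v \<Rightarrow> 'v \<Rightarrow> real"
  assumes E: "simple_graph E" and k: "1 \<le> k"
    and sym: "\<And>u v. P u v = P v u"
    and idem: "\<And>u. (\<Sum>v\<in>UNIV. (P u v)\<^sup>2) = P u u"
    and psd: "\<And>u v. - 2 * P u v \<le> P u u + P v v"
    and trace: "(\<Sum>u\<in>UNIV. P u u) = real k"
  shows "(\<Sum>e\<in>E. (\<Sum>u\<in>e. \<Sum>v\<in>e - {u}. P u u - P u v) - 1)
    \<le> real (MAX U\<in>{U :: 'v set. card U = k}. card (edges_within E U))
      + (4 * real k - 2) * sqrt (real k)"
proof -
  define p where "p u = P u u" for u
  define F where "F e = (\<Sum>u\<in>e. \<Sum>v\<in>e - {u}. P u u - P u v)" for e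
  have F: "F {u, v} = p u + p v - 2 * P u v" if "u \<noteq> v" for u v
    using that sym[of u v] by (simp add: F_def p_def insert_Diff_if)
  have p_nonneg: "0 \<le> p u" for u
    unfolding p_def idem[symmetric] by (simp add: sum_nonneg)
  have off: "(\<Sum>v\<in>UNIV - {u}. (P u v)\<^sup>2) = p u * (1 - p u)" for u
    using idem[of u] by (simp add: sum.remove[of UNIV u] p_def power2_eq_square algebra_simps)
  have p_le: "p u \<le> 1" for u
  proof (rule ccontr)
    assume "\<not> p u \<le> 1"
    then have "p u * (1 - p u) < 0" by (simp add: mult_less_0_iff)
    moreover have "0 \<le> (\<Sum>v\<in>UNIV - {u}. (P u v)\<^sup>2)" by (simp add: sum_nonneg)
    ultimately show False using off[of u] by simp
  qed
  have off_le: "(P u v)\<^sup>2 \<le> p u * (1 - p u)" if "u \<noteq> v" for u v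
    unfolding off[symmetric] using that by (intro member_le_sum) auto

  define E' where "E' = {e \<in> E. F e > 1}"
  have E': "simple_graph E'" using E by (auto simp: E'_def simple_graph_def)
  have "{} \<notin> E'" using E' by (auto simp: simple_graph_def)
  then obtain N where N: "N \<subseteq> E'" "disjoint N" and cover: "\<And>e. e \<in> E' \<Longrightarrow> e \<inter> \<Union>N \<noteq> {}"
    using ex_maximal_disjoint_subfamily[of E'] by auto
  define B where "B = \<Union>N"
  define m where "m = real (card B)"
  define q where "q = sum p B"
  have card2: "card e = 2" if "e \<in> N" for e
    using that N(1) E' by (auto simp: simple_graph_def)
  have q: "0 \<le> q" "q \<le> real k"
    using p_nonneg trace sum_mono2[of UNIV B p] by (auto simp: q_def p_def sum_nonneg)
  have cardB: "card B = 2 * card N"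
  proof -
    have "card B = (\<Sum>e\<in>N. card e)"
      unfolding B_def by (intro card_Union_disjoint N(2)) simp
    also have "\<dots> = 2 * card N" using card2 by simp
    finally show ?thesis .
  qed
  \<comment> \<open>Each edge of \<open>N\<close> has weight above 1, while the total is at most
    \<open>2 * q \<le> 2 * k\<close>. Strictness saves one edge, hence two vertices of the
    cover.\<close>
  have "card N \<le> 2 * k - 1"
  proof (cases "N = {}")
    case False
    have "real (card N) < (\<Sum>e\<in>N. F e)"
      using sum_strict_mono[of N "\<lambda>_. 1" F] N(1) False by (auto simp: E'_def)
    also have "\<dots> \<le> (\<Sum>e\<in>N. 2 * sum p e)"
    proof (rule sum_mono)
      fix e assume "e \<in> N"
      then have "e \<in> E" using N(1) by (auto simp: E'_def)
      then obtain u v where "e = {u, v}" "u \<noteq> v" using simple_graph_edgeE[OF E] by metis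
      then show "F e \<le> 2 * sum p e" using psd[of u v] by (simp add: F) (simp add: p_def)
    qed
    also have "\<dots> = 2 * q"
      unfolding q_def B_def sum_distrib_left[symmetric]
      using N(2) by (subst sum.Union_disjoint) (auto simp: disjoint_def)
    also have "\<dots> \<le> 2 * real k" using q by simp
    finally show ?thesis by linarith
  qed simp
  then have m: "m \<le> 4 * real k - 2"
    using cardB k by (simp add: m_def)

  define a where "a = sqrt (real k)"
  have a: "a \<ge> 1" using k by (simp add: a_def)
  define w where "w v = (if v \<in> B then 1 / 2 else 1 :: real)" for v
  define b where "b u v = a * ((P u v)\<^sup>2 / (1 - p u)) + p v / a" for u v
  define c where "c u v = (if u \<in> B then w v * b u v else 0)" for u v
  have b_nonneg: "0 \<le> b u v" for u v
    using a p_nonneg[of v] p_le[of u] by (simp add: b_def)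
  have c_nonneg: "0 \<le> c u v" for u v
    using b_nonneg[of u v] by (simp add: c_def w_def)
  have edge: "F e - 1 \<le> max 0 (sum p e - 1) + (\<Sum>u\<in>e. \<Sum>v\<in>e - {u}. c u v)" if "e \<in> E'" for e
  proof -
    obtain u v where e: "e = {u, v}" and uv: "u \<noteq> v"
      using simple_graph_edgeE[OF E' \<open>e \<in> E'\<close>] .
    have "2 * \<bar>P u v\<bar> - max 0 (1 - (p u + p v)) \<le> b u v"
      unfolding b_def by (rule offdiag_excess_le[OF a p_le p_nonneg off_le[OF uv]])
    moreover have "2 * \<bar>P u v\<bar> - max 0 (1 - (p u + p v)) \<le> b v u"
      using offdiag_excess_le[OF a p_le p_nonneg off_le[OF uv[symmetric]], of u]
      unfolding b_def by (simp add: sym[of v u] add.commute)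
    moreover have "u \<in> B \<or> v \<in> B"
      using cover[OF that] e by (auto simp: B_def)
    \<comment> \<open>\<open>b u v\<close> and \<open>b v u\<close> bound the same quantity: an edge
      inside \<open>B\<close> takes half of each, any other edge the full bound from its end in
      \<open>B\<close>.\<close>
    ultimately have "2 * \<bar>P u v\<bar> - max 0 (1 - (p u + p v)) \<le> c u v + c v u"
      by (auto simp: c_def w_def)
    \<comment> \<open>This splits \<open>r = max 0 r - max 0 (- r)\<close> for
      \<open>r = p u + p v - 1\<close>; the negative part offsets the off-diagonal term.\<close>
    moreover have "F e - 1 \<le> max 0 (p u + p v - 1) + (2 * \<bar>P u v\<bar> - max 0 (1 - (p u + p v)))"
      unfolding e F[OF uv] by (simp add: max_def)
    moreover have "(\<Sum>u\<in>e. \<Sum>v\<in>e - {u}. c u v) = c u v + c v u"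
      using uv by (simp add: e insert_Diff_if)
    ultimately show ?thesis using uv by (simp add: e)
  qed

  have row: "(\<Sum>v | {u, v} \<in> E'. c u v) \<le> (if u \<in> B then a * p u + ((q - p u) / 2 + (real k - q)) / a else 0)" for u
  proof (cases "u \<in> B")
    case True
    have "(\<Sum>v | {u, v} \<in> E'. c u v) \<le> (\<Sum>v\<in>UNIV - {u}. c u v)"
      using E' c_nonneg by (intro sum_mono2) (auto simp: simple_graph_def)
    also have "\<dots> \<le> (\<Sum>v\<in>UNIV - {u}. a * ((P u v)\<^sup>2 / (1 - p u)) + w v * p v / a)"
    proof (rule sum_mono)
      fix v
      \<comment> \<open>Only the term with \<open>p v\<close> keeps the factor \<open>w v\<close>;
        the squared term is taken at full weight, so that \<open>off\<close> evaluates its row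
        sum.\<close>
      have "w v * (a * ((P u v)\<^sup>2 / (1 - p u))) \<le> 1 * (a * ((P u v)\<^sup>2 / (1 - p u)))"
        using a p_le[of u] by (intro mult_right_mono) (auto simp: w_def)
      then show "c u v \<le> a * ((P u v)\<^sup>2 / (1 - p u)) + w v * p v / a"
        using True by (simp add: c_def b_def distrib_left)
    qed
    also have "\<dots> = a * ((p u * (1 - p u)) / (1 - p u)) + (\<Sum>v\<in>UNIV - {u}. w v * p v) / a"
      by (simp add: sum.distrib sum_distrib_left[symmetric] sum_divide_distrib[symmetric] off)
    also have "(\<Sum>v\<in>UNIV - {u}. w v * p v) = (q - p u) / 2 + (real k - q)"
    proof -
      have "(\<Sum>v\<in>UNIV. w v * p v) = (\<Sum>v\<in>UNIV. p v) - (\<Sum>v\<in>UNIV. if v \<in> B then p v / 2 else 0)"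
        unfolding sum_subtractf[symmetric] by (intro sum.cong) (auto simp: w_def)
      also have "\<dots> = real k - q / 2"
        using trace by (simp add: sum.If_cases q_def p_def sum_divide_distrib)
      finally show ?thesis
        using True by (simp add: sum.remove[of UNIV u] w_def field_simps)
    qed
    \<comment> \<open>Equality fails only for \<open>p u = 1\<close>, where division by zero makes
      the left side 0.\<close>
    also have "a * ((p u * (1 - p u)) / (1 - p u)) \<le> a * p u"
      using a p_nonneg[of u] by (intro mult_left_mono) auto
    finally show ?thesis using True by simp
  next
    case False
    then show ?thesis by (simp add: c_def)
  qed

  have "(\<Sum>e\<in>E. F e - 1) \<le> (\<Sum>e\<in>E'. F e - 1)"
  proof -
    have "(\<Sum>e\<in>E. F e - 1) \<le> (\<Sum>e\<in>E. if F e > 1 then F e - 1 else 0)"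
      by (intro sum_mono) auto
    also have "\<dots> = (\<Sum>e\<in>E'. F e - 1)"
      by (simp add: sum.If_cases E'_def Int_def)
    finally show ?thesis .
  qed
  also have "\<dots> \<le> (\<Sum>e\<in>E'. max 0 (sum p e - 1)) + (\<Sum>e\<in>E'. \<Sum>u\<in>e. \<Sum>v\<in>e - {u}. c u v)"
    unfolding sum.distrib[symmetric] by (intro sum_mono edge)
  also have "(\<Sum>e\<in>E'. max 0 (sum p e - 1)) \<le> (\<Sum>e\<in>E. max 0 (sum p e - 1))"
    by (intro sum_mono2) (auto simp: E'_def)
  also have "\<dots> \<le> real (MAX U\<in>{U :: 'v set. card U = k}. card (edges_within E U))"
    using trace by (intro sum_pos_part_le_max_edges_within[OF E p_nonneg p_le]) (simp add: p_def)
  \<comment> \<open>Regrouped by the charged end, the sum runs over rows, and only rows in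
    \<open>B\<close> contribute.\<close>
  also have "(\<Sum>e\<in>E'. \<Sum>u\<in>e. \<Sum>v\<in>e - {u}. c u v)
      \<le> (\<Sum>u\<in>UNIV. if u \<in> B then a * p u + ((q - p u) / 2 + (real k - q)) / a else 0)"
    unfolding sum_edges_ordered_pairs[OF E'] by (intro sum_mono row)
  also have "\<dots> = (\<Sum>u\<in>B. a * p u + ((q - p u) / 2 + (real k - q)) / a)"
    by (simp add: sum.If_cases)
  also have "\<dots> = a * q + ((m * q - q) / 2 + m * (real k - q)) / a"
    by (simp add: sum.distrib sum_subtractf sum_distrib_left[symmetric] sum_divide_distrib[symmetric]
        q_def[symmetric] m_def)
  also have "\<dots> \<le> (4 * real k - 2) * sqrt (real k)"
    unfolding a_def using k q m by (intro cover_total_le) auto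
  finally show ?thesis by (simp add: F_def)
qed

section \<open>From Laplacian eigenvectors to the projection\<close>

lemma transpose_laplacian: "transpose (laplacian E) = laplacian E"
  by (auto simp: vec_eq_iff transpose_def laplacian_def insert_commute)

text \<open>\<open>P\<close> projects onto the span of the \<open>x i\<close>. Each
  \<open>c i\<close> is the Laplacian form at the unit vector \<open>x i\<close>, and summing its
  edge terms over \<open>i\<close> yields entries of \<open>P\<close>.\<close>

lemma sum_laplacian_eigenvalues_le:
  fixes E :: "'v::finite set set" and x :: "'i \<Rightarrow> real ^ 'v"
  assumes E: "simple_graph E" and I: "finite I" "card I = k" "1 \<le> k"
    and orth: "\<And>i j. i \<in> I \<Longrightarrow> j \<in> I \<Longrightarrow> x i \<bullet> x j = (if i = j then 1 else 0)"
    and eig: "\<And>i. i \<in> I \<Longrightarrow> laplacian E *v x i = c i *\<^sub>R x i"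
  shows "(\<Sum>i\<in>I. c i) - real (card E)
    \<le> real (MAX U\<in>{U :: 'v set. card U = k}. card (edges_within E U))
      + (4 * real k - 2) * sqrt (real k)"
proof -
  define P where "P u v = (\<Sum>i\<in>I. x i $ u * x i $ v)" for u v
  have orth': "(\<Sum>v\<in>UNIV. x i $ v * x j $ v) = (if i = j then 1 else 0)" if "i \<in> I" "j \<in> I" for i j
    using orth[OF that] by (simp add: inner_vec_def)
  have sym: "P u v = P v u" for u v
    by (simp add: P_def mult.commute)
  \<comment> \<open>Orthonormality collapses the double sum over \<open>i\<close> and
    \<open>j\<close> to its diagonal.\<close>
  have idem: "(\<Sum>v\<in>UNIV. (P u v)\<^sup>2) = P u u" for u
  proof -
    have "(\<Sum>v\<in>UNIV. (P u v)\<^sup>2)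
        = (\<Sum>v\<in>UNIV. \<Sum>i\<in>I. \<Sum>j\<in>I. x i $ u * x j $ u * (x i $ v * x j $ v))"
      unfolding P_def power2_eq_square sum_product by (simp add: mult_ac)
    also have "\<dots> = (\<Sum>i\<in>I. \<Sum>v\<in>UNIV. \<Sum>j\<in>I. x i $ u * x j $ u * (x i $ v * x j $ v))"
      by (rule sum.swap)
    also have "\<dots> = (\<Sum>i\<in>I. \<Sum>j\<in>I. \<Sum>v\<in>UNIV. x i $ u * x j $ u * (x i $ v * x j $ v))"
      by (intro sum.cong refl sum.swap)
    also have "\<dots> = (\<Sum>i\<in>I. \<Sum>j\<in>I. if i = j then x i $ u * x j $ u else 0)"
      unfolding sum_distrib_left[symmetric] by (intro sum.cong refl) (simp add: orth')
    also have "\<dots> = P u u"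
      using I(1) by (simp add: P_def)
    finally show ?thesis .
  qed
  have psd: "- 2 * P u v \<le> P u u + P v v" for u v
  proof -
    have "0 \<le> (\<Sum>i\<in>I. (x i $ u + x i $ v)\<^sup>2)" by (simp add: sum_nonneg)
    also have "\<dots> = P u u + P v v + 2 * P u v"
      by (simp add: P_def sum.distrib[symmetric] sum_distrib_left power2_eq_square algebra_simps)
    finally show ?thesis by simp
  qed
  have trace: "(\<Sum>u\<in>UNIV. P u u) = real k"
    unfolding P_def by (subst sum.swap) (simp add: orth' I(2))
  have "(\<Sum>i\<in>I. c i) = (\<Sum>i\<in>I. x i \<bullet> (laplacian E *v x i))"
    by (intro sum.cong refl) (simp add: eig orth)
  also have "\<dots> = (\<Sum>i\<in>I. \<Sum>e\<in>E. \<Sum>u\<in>e. \<Sum>v\<in>e - {u}. x i $ u * x i $ u - x i $ u * x i $ v)"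
    by (simp only: laplacian_quadratic_form[OF E])
  also have "\<dots> = (\<Sum>e\<in>E. \<Sum>i\<in>I. \<Sum>u\<in>e. \<Sum>v\<in>e - {u}. x i $ u * x i $ u - x i $ u * x i $ v)"
    by (rule sum.swap)
  also have "\<dots> = (\<Sum>e\<in>E. \<Sum>u\<in>e. \<Sum>i\<in>I. \<Sum>v\<in>e - {u}. x i $ u * x i $ u - x i $ u * x i $ v)"
    by (intro sum.cong refl sum.swap)
  also have "\<dots> = (\<Sum>e\<in>E. \<Sum>u\<in>e. \<Sum>v\<in>e - {u}. \<Sum>i\<in>I. x i $ u * x i $ u - x i $ u * x i $ v)"
    by (intro sum.cong refl sum.swap)
  also have "\<dots> = (\<Sum>e\<in>E. \<Sum>u\<in>e. \<Sum>v\<in>e - {u}. P u u - P u v)"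
    by (simp only: P_def sum_subtractf)
  finally have "(\<Sum>i\<in>I. c i) - real (card E) = (\<Sum>e\<in>E. (\<Sum>u\<in>e. \<Sum>v\<in>e - {u}. P u u - P u v) - 1)"
    by (simp only: sum_subtractf[of _ "\<lambda>_. 1"] sum_constant mult_1_right)
  then show ?thesis
    using sum_edge_weights_of_projection_le[OF E I(3) sym idem psd trace] by simp
qed

theorem theorem1p2:
  fixes E :: "'v::finite set set" and k :: nat
  assumes "simple_graph E"
    and "1 \<le> k" and "k \<le> CARD('v)"
  shows "graph_eps k E
    \<le> real (MAX U\<in>{U :: 'v set. card U = k}. card (edges_within E U))
      + (4 * real k - 2) * sqrt (real k)"
proof -
  obtain x :: "'v \<Rightarrow> real ^ 'v" and c where
    x: "\<And>i j. x i \<bullet> x j = (if i = j then 1 else 0)" "\<And>i. laplacian E *v x i = c i *\<^sub>R x i"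
    by (rule symmetric_matrix_orthonormal_eigenvectors[OF transpose_laplacian[of E]]) (rule that)
  obtain I where "card I = k" "(\<Sum>i=1..k. eigval (laplacian E) i) = (\<Sum>i\<in>I. c i)"
    using sum_eigval_eq_sum_eigenvectors[OF x assms(3)] .
  then show ?thesis
    using sum_laplacian_eigenvalues_le[OF assms(1) finite _ assms(2) x] by (simp add: graph_eps_def)
qed

end
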